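(* Let $G$ be a connected simple graph with $n=|V(G)|$ vertices and minimum degree $\delta=\delta(G)$, let $k\in(0,n)$ be a real number with $\delta\le\frac{n-k}{2}$, and let $\alpha$ be a real number with $0\le\alpha\le 1$. Each of the following holds. (i) If $\alpha=0$ and $\lambda_1(A_{\alpha}(G))<\delta\sqrt{1+\frac{2k}{n-k}}$, then $\mu_{f}(G)>\frac{n-k}{2}$. (ii) If $0<\alpha\le\frac12$ and $\lambda_1(A_{\alpha}(G))<\frac{2\alpha\delta n}{n-k}$, then $\mu_{f}(G)>\frac{n-k}{2}$. (iii) If $\frac12<\alpha\le 1$ and $\lambda_1(A_{\alpha}(G))<\frac{\alpha\delta(n+k)}{n-k}$, then $\mu_{f}(G)>\frac{n-k}{2}$. (iv) If $\lambda_1(A_{\alpha}(\overline{G}))<\delta+k-1$, then $\mu_{f}(G)>\frac{n-k}{2}$.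
   Context: Graphs are finite, simple and undirected. $\overline{G}$ is the complement of $G$. For a graph $H$ with adjacency matrix $A(H)$ and diagonal degree matrix $D(H)$, and $\alpha\in[0,1]$, put $A_\alpha(H)=\alpha D(H)+(1-\alpha)A(H)$; $\lambda_1(M)$ denotes the largest eigenvalue of a real symmetric matrix $M$. A fractional matching of $G$ is a function $f:E(G)\to[0,1]$ such that for every vertex $v$ the sum of $f(e)$ over all edges $e$ incident with $v$ is at most $1$. The fractional matching number is $\mu_f(G)=\max\{\sum_{e\in E(G)}f(e): f \text{ is a fractional matching of } G\}$. *)

theory Defs
  imports "HOL-Analysis.Analysis"
begin

text \<open>A finite simple graph is given by its set of edges, each a two-element set of vertices.
  The vertex set is the whole of the finite type \<^typ>\<open>'v\<close>, so the order of the graph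
  is \<^term>\<open>CARD('v)\<close>.\<close>

definition simple_graph :: "'v::finite set set \<Rightarrow> bool" where
  "simple_graph E \<longleftrightarrow> (\<forall>e\<in>E. card e = 2)"

definition graph_complement :: "'v::finite set set \<Rightarrow> 'v set set" where
  "graph_complement E = {e. card e = 2 \<and> e \<notin> E}"

definition connected_graph :: "'v::finite set set \<Rightarrow> bool" where
  "connected_graph E \<longleftrightarrow> (\<forall>u v. (u, v) \<in> {(x, y). {x, y} \<in> E}\<^sup>*)"

definition degree :: "'v::finite set set \<Rightarrow> 'v \<Rightarrow> nat" where
  "degree E v = card {e \<in> E. v \<in> e}"

definition min_degree :: "'v::finite set set \<Rightarrow> nat" where
  "min_degree E = Min (range (degree E))"

definition adjacency_matrix :: "'v::finite set set \<Rightarrow> real^'v^'v" where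
  "adjacency_matrix E = (\<chi> i j. if {i, j} \<in> E then 1 else 0)"

definition degree_matrix :: "'v::finite set set \<Rightarrow> real^'v^'v" where
  "degree_matrix E = (\<chi> i j. if i = j then real (degree E i) else 0)"

definition A_alpha :: "real \<Rightarrow> 'v::finite set set \<Rightarrow> real^'v^'v" where
  "A_alpha \<alpha> E = \<alpha> *\<^sub>R degree_matrix E + (1 - \<alpha>) *\<^sub>R adjacency_matrix E"

definition eigenvalue :: "real^'n^'n \<Rightarrow> real \<Rightarrow> bool" where
  "eigenvalue M l \<longleftrightarrow> (\<exists>x. x \<noteq> 0 \<and> M *v x = l *\<^sub>R x)"

definition largest_eigenvalue :: "real^'n^'n \<Rightarrow> real" where
  "largest_eigenvalue M = (GREATEST l. eigenvalue M l)"

lemma largest_eigenvalue_maximum: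
  fixes M :: "real^'n^'n"
  assumes sym: "transpose M = M"
  shows "eigenvalue M (largest_eigenvalue M)"
    and "eigenvalue M l \<Longrightarrow> l \<le> largest_eigenvalue M"
proof -
  have comm: "y \<bullet> (M *v x) = x \<bullet> (M *v y)" for x y
    by (metis dot_lmul_matrix inner_commute sym transpose_matrix_vector)
  have "continuous_on (sphere 0 1) (\<lambda>x::real^'n. x \<bullet> (M *v x))"
    by (intro continuous_intros)
  moreover have "axis undefined 1 \<in> sphere (0::real^'n) 1" by simp
  ultimately obtain x :: "real^'n" where x: "norm x = 1"
    and max: "\<And>y. norm y = 1 \<Longrightarrow> y \<bullet> (M *v y) \<le> x \<bullet> (M *v x)"
    using continuous_attains_sup[OF compact_sphere, of "0::real^'n" 1 "\<lambda>x. x \<bullet> (M *v x)"]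
    by (auto simp: dist_norm)
  define m where "m = x \<bullet> (M *v x)"
  have rayleigh: "y \<bullet> (M *v y) \<le> m * (y \<bullet> y)" for y
  proof (cases "y = 0")
    case False
    have "(y /\<^sub>R norm y) \<bullet> (M *v (y /\<^sub>R norm y)) \<le> m"
      unfolding m_def using False by (intro max) simp
    then have "(y \<bullet> (M *v y)) / (norm y)\<^sup>2 \<le> m"
      by (simp add: matrix_vector_mult_scaleR power2_eq_square divide_inverse mult_ac)
    then show ?thesis
      using False by (simp add: divide_le_eq power2_norm_eq_inner)
  qed simp
  define w where "w = M *v x - m *\<^sub>R x"
  have xx: "x \<bullet> x = 1" using x by (simp add: norm_eq_1)
  have lin: "2 * (t * (w \<bullet> w)) \<le> t\<^sup>2 * (m * (w \<bullet> w) - w \<bullet> (M *v w))" for t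
  proof -
    have "w \<bullet> (M *v x) = w \<bullet> w + m * (w \<bullet> x)"
      by (simp add: w_def algebra_simps)
    then have wx: "w \<bullet> (M *v x) = w \<bullet> w + m * (x \<bullet> w)"
      by (simp only: inner_commute[of x w])
    have "(x + t *\<^sub>R w) \<bullet> (M *v (x + t *\<^sub>R w)) =
        x \<bullet> (M *v x) + t * (x \<bullet> (M *v w)) + t * (w \<bullet> (M *v x)) + t\<^sup>2 * (w \<bullet> (M *v w))"
      by (simp add: matrix_vector_right_distrib matrix_vector_mult_scaleR inner_add_left
          inner_add_right power2_eq_square ring_distribs)
    then have lhs: "(x + t *\<^sub>R w) \<bullet> (M *v (x + t *\<^sub>R w)) =
        m + 2 * t * (w \<bullet> w + m * (x \<bullet> w)) + t\<^sup>2 * (w \<bullet> (M *v w))"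
      by (simp only: m_def[symmetric] comm[of w x, symmetric] wx)
    have rhs: "(x + t *\<^sub>R w) \<bullet> (x + t *\<^sub>R w) = 1 + 2 * t * (x \<bullet> w) + t\<^sup>2 * (w \<bullet> w)"
      by (simp add: inner_add_left inner_add_right power2_eq_square ring_distribs xx
          inner_commute[of w x])
    show ?thesis
      using rayleigh[of "x + t *\<^sub>R w"] unfolding lhs rhs by (simp add: algebra_simps)
  qed
  have "w \<bullet> w \<le> 0"
  proof (rule ccontr)
    assume "\<not> w \<bullet> w \<le> 0"
    then have pos: "w \<bullet> w > 0" by linarith
    define c where "c = \<bar>m * (w \<bullet> w) - w \<bullet> (M *v w)\<bar> + 1"
    have c: "c > 0" "m * (w \<bullet> w) - w \<bullet> (M *v w) \<le> c" by (auto simp: c_def)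
    define t where "t = (w \<bullet> w) / c"
    have t: "t > 0" using pos c by (simp add: t_def)
    have "2 * (t * (w \<bullet> w)) \<le> t\<^sup>2 * c"
      using lin[of t] mult_left_mono[OF c(2), of "t\<^sup>2"] by simp
    also have "\<dots> = t * (w \<bullet> w)" using c by (simp add: t_def power2_eq_square)
    finally show False using mult_pos_pos[OF t pos] by simp
  qed
  then have "w = 0" using inner_ge_zero[of w] by (metis inner_eq_zero_iff order_antisym)
  then have ev: "eigenvalue M m"
    unfolding eigenvalue_def using x by (intro exI[of _ x]) (auto simp: w_def)
  have le: "l \<le> m" if l: "eigenvalue M l" for l
  proof -
    obtain y where y: "y \<noteq> 0" "M *v y = l *\<^sub>R y" using l unfolding eigenvalue_def by blast
    have "l * (y \<bullet> y) \<le> m * (y \<bullet> y)" using rayleigh[of y] unfolding y(2) inner_scaleR_right .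
    moreover have "y \<bullet> y > 0" using y(1) by (simp only: inner_gt_zero_iff not_False_eq_True)
    ultimately show ?thesis by (rule mult_right_le_imp_le)
  qed
  have eq: "largest_eigenvalue M = m"
    unfolding largest_eigenvalue_def by (rule Greatest_equality) (use ev le in auto)
  show "eigenvalue M (largest_eigenvalue M)"
    and "eigenvalue M l \<Longrightarrow> l \<le> largest_eigenvalue M"
    using ev le eq by auto
qed

lemma transpose_A_alpha: "transpose (A_alpha \<alpha> E) = A_alpha \<alpha> E"
  by (simp add: A_alpha_def degree_matrix_def adjacency_matrix_def transpose_def vec_eq_iff
      insert_commute)

text \<open>Only the values of \<^term>\<open>f\<close> on \<^term>\<open>E\<close> matter.\<close>

definition fractional_matching :: "'v::finite set set \<Rightarrow> ('v set \<Rightarrow> real) \<Rightarrow> bool" where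
  "fractional_matching E f \<longleftrightarrow>
     (\<forall>e\<in>E. 0 \<le> f e \<and> f e \<le> 1) \<and> (\<forall>v. (\<Sum>e\<in>{e \<in> E. v \<in> e}. f e) \<le> 1)"

text \<open>The set of sizes is infinite in general, which rules out \<^const>\<open>Max\<close>; that the
  greatest element exists is shown below.\<close>

definition fractional_matching_number :: "'v::finite set set \<Rightarrow> real" where
  "fractional_matching_number E =
     (GREATEST s. \<exists>f. fractional_matching E f \<and> s = (\<Sum>e\<in>E. f e))"

lemma fractional_matching_number_maximum:
  fixes E :: "'v::finite set set"
  shows "\<exists>f. fractional_matching E f \<and> fractional_matching_number E = (\<Sum>e\<in>E. f e)"
    and "fractional_matching E g \<Longrightarrow> (\<Sum>e\<in>E. g e) \<le> fractional_matching_number E"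
proof -
  define K :: "(real^'v set) set" where
    "K = {x. (\<forall>e. 0 \<le> x $ e \<and> x $ e \<le> 1) \<and> (\<forall>v. (\<Sum>e\<in>{e \<in> E. v \<in> e}. x $ e) \<le> 1)}"
  have "closed K"
    unfolding K_def
    by (intro closed_Collect_conj closed_Collect_all closed_Collect_le continuous_intros)
  moreover have "bounded K"
    by (rule bounded_subset[of "cbox 0 1"]) (auto simp: K_def mem_box_cart)
  ultimately have "compact K" by (simp add: compact_eq_bounded_closed)
  moreover have "0 \<in> K" by (simp add: K_def)
  moreover have "continuous_on K (\<lambda>x. \<Sum>e\<in>E. x $ e)" by (intro continuous_intros)
  ultimately obtain x where x: "x \<in> K"
    and max: "\<And>y. y \<in> K \<Longrightarrow> (\<Sum>e\<in>E. y $ e) \<le> (\<Sum>e\<in>E. x $ e)"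
    using continuous_attains_sup[of K "\<lambda>x. \<Sum>e\<in>E. x $ e"] by blast
  have fx: "fractional_matching E (\<lambda>e. x $ e)"
    using x by (auto simp: K_def fractional_matching_def)
  have le: "(\<Sum>e\<in>E. g e) \<le> (\<Sum>e\<in>E. x $ e)" if g: "fractional_matching E g" for g
  proof -
    let ?y = "\<chi> e. if e \<in> E then g e else 0"
    have eq: "(\<Sum>e\<in>A. ?y $ e) = (\<Sum>e\<in>A. g e)" if "A \<subseteq> E" for A
      using that by (intro sum.cong) auto
    have "?y \<in> K"
      using g unfolding K_def fractional_matching_def by (auto simp: eq simp del: vec_lambda_beta) auto
    from max[OF this] show ?thesis by (simp add: eq del: vec_lambda_beta)
  qed
  have eq: "fractional_matching_number E = (\<Sum>e\<in>E. x $ e)"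
    unfolding fractional_matching_number_def by (rule Greatest_equality) (use fx le in auto)
  show "\<exists>f. fractional_matching E f \<and> fractional_matching_number E = (\<Sum>e\<in>E. f e)"
    using fx eq by blast
  show "fractional_matching E g \<Longrightarrow> (\<Sum>e\<in>E. g e) \<le> fractional_matching_number E"
    using le eq by simp
qed

end

theory Submission
  imports Defs
begin

text \<open>A matching of the bipartite double cover of the graph, halved, is a fractional matching.
  By the deficiency version of Hall's theorem, \<open>\<mu>\<^sub>f \<le> (n - k) / 2\<close> therefore yields a set \<open>S\<close> with
  \<open>|S| \<ge> |N(S)| + k\<close>, and passing to \<open>S - N(S)\<close> makes \<open>S\<close> independent. All edges
  at \<open>S\<close> then run to \<open>T = N(S)\<close>, so there are at least \<open>\<delta> |S|\<close> of them. The Rayleigh quotient of the vector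
  equal to \<open>a\<close> on \<open>S\<close>, \<open>b\<close> on \<open>T\<close> and \<open>0\<close> elsewhere gives parts (i)--(iii) for suitable
  \<open>a\<close> and \<open>b\<close>; the indicator vector of \<open>S\<close>, a clique of the complement, gives part (iv).\<close>

section \<open>Rayleigh quotients\<close>

text \<open>The maximum \<open>m\<close> of the quadratic form on the unit sphere is attained at
  some \<open>x\<close>, and the first-order condition there makes \<open>x\<close> an eigenvector
  for \<open>m\<close>.\<close>

lemma rayleigh_le_largest_eigenvalue:
  fixes M :: "real^'n^'n"
  assumes sym: "transpose M = M"
  shows "y \<bullet> (M *v y) \<le> largest_eigenvalue M * (y \<bullet> y)"
proof -
  have comm: "u \<bullet> (M *v v) = v \<bullet> (M *v u)" for u v
    by (metis dot_lmul_matrix inner_commute sym transpose_matrix_vector)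
  have "continuous_on (sphere 0 1) (\<lambda>x::real^'n. x \<bullet> (M *v x))"
    by (intro continuous_intros)
  moreover have "axis undefined 1 \<in> sphere (0::real^'n) 1" by simp
  ultimately obtain x :: "real^'n" where x: "norm x = 1"
    and max: "\<And>z. norm z = 1 \<Longrightarrow> z \<bullet> (M *v z) \<le> x \<bullet> (M *v x)"
    using continuous_attains_sup[OF compact_sphere, of "0::real^'n" 1 "\<lambda>x. x \<bullet> (M *v x)"]
    by (auto simp: dist_norm)
  define m where "m = x \<bullet> (M *v x)"
  define B where "B z = m *\<^sub>R z - M *v z" for z
  have B_nonneg: "0 \<le> z \<bullet> B z" for z
  proof (cases "z = 0")
    case False
    have "(z /\<^sub>R norm z) \<bullet> (M *v (z /\<^sub>R norm z)) \<le> m"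
      unfolding m_def using False by (intro max) simp
    then have "(z \<bullet> (M *v z)) / (norm z)\<^sup>2 \<le> m"
      by (simp add: matrix_vector_mult_scaleR power2_eq_square divide_inverse mult_ac)
    then show ?thesis
      using False by (simp add: B_def inner_diff_right divide_le_eq power2_norm_eq_inner)
  qed simp
  have Bx: "x \<bullet> B x = 0"
    using x by (simp add: B_def inner_diff_right m_def norm_eq_1)
  \<comment> \<open>The form of \<open>B\<close> is nonnegative and vanishes at \<open>x\<close>.
    Along the line through \<open>x\<close> in direction \<open>B x\<close> it is therefore minimal
    at \<open>t = 0\<close>, so its derivative there, twice the squared norm of \<open>w\<close>,
    must vanish.\<close>
  define w where "w = B x"
  have "w \<bullet> B x = x \<bullet> B w"
    by (simp only: B_def inner_diff_right inner_scaleR_right comm[of w x] inner_commute[of w x])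
  then have xBw: "x \<bullet> B w = w \<bullet> w"
    by (simp add: w_def)
  have expand: "(x + t *\<^sub>R w) \<bullet> B (x + t *\<^sub>R w) = 2 * t * (w \<bullet> w) + t\<^sup>2 * (w \<bullet> B w)" for t
  proof -
    have "B (x + t *\<^sub>R w) = w + t *\<^sub>R B w"
      by (simp add: B_def w_def matrix_vector_right_distrib matrix_vector_mult_scaleR algebra_simps)
    then show ?thesis
      using Bx xBw
      by (simp add: inner_add_left inner_add_right power2_eq_square algebra_simps
          flip: w_def)
  qed
  have "((\<lambda>t. 2 * t * (w \<bullet> w) + t\<^sup>2 * (w \<bullet> B w)) has_real_derivative 2 * (w \<bullet> w)) (at 0)"
    by (auto intro!: derivative_eq_intros)
  then have "2 * (w \<bullet> w) = 0"
    by (rule DERIV_local_min[where d = 1]) (use B_nonneg expand in \<open>metis | simp\<close>)+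
  then have "M *v x = m *\<^sub>R x"
    by (simp add: w_def B_def)
  then have "eigenvalue M m"
    unfolding eigenvalue_def using x by (intro exI[of _ x]) auto
  then have "m \<le> largest_eigenvalue M"
    by (rule largest_eigenvalue_maximum(2)[OF sym])
  moreover have "y \<bullet> (M *v y) \<le> m * (y \<bullet> y)"
    using B_nonneg[of y] by (simp add: B_def inner_diff_right)
  ultimately show ?thesis
    by (meson inner_ge_zero mult_right_mono order_trans)
qed

text \<open>Each edge becomes two ordered pairs. As a relation this makes relational image the
  neighbourhood operator, and it is also the edge set of the bipartite double cover.\<close>

definition arcs :: "'v::finite set set \<Rightarrow> ('v \<times> 'v) set" where
  "arcs E = {(u, v). {u, v} \<in> E}"

lemma degree_eq_card_arcs:
  assumes "simple_graph E"
  shows "degree E v = card (arcs E `` {v})"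
proof -
  have "bij_betw (\<lambda>w. {v, w}) (arcs E `` {v}) {e \<in> E. v \<in> e}"
  proof (rule bij_betw_imageI)
    show "inj_on (\<lambda>w. {v, w}) (arcs E `` {v})"
      by (auto simp: inj_on_def doubleton_eq_iff)
    show "(\<lambda>w. {v, w}) ` (arcs E `` {v}) = {e \<in> E. v \<in> e}"
    proof (intro equalityI subsetI)
      fix e assume e: "e \<in> {e \<in> E. v \<in> e}"
      then have "card e = 2" using assms by (simp add: simple_graph_def)
      with e obtain w where "e = {v, w}" by (auto simp: card_2_iff doubleton_eq_iff)
      with e show "e \<in> (\<lambda>w. {v, w}) ` (arcs E `` {v})" by (auto simp: arcs_def)
    qed (auto simp: arcs_def)
  qed
  then show ?thesis unfolding degree_def by (simp add: bij_betw_same_card)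
qed

text \<open>The degree of \<open>i\<close> is the number of arcs leaving \<open>i\<close>, so the
  diagonal term can be distributed over those arcs.\<close>

lemma A_alpha_quadratic_form:
  assumes "simple_graph E"
  shows "x \<bullet> (A_alpha \<alpha> E *v x) = (\<Sum>(i, j)\<in>arcs E. \<alpha> * (x $ i)\<^sup>2 + (1 - \<alpha>) * (x $ i * x $ j))"
proof -
  have arcs: "arcs E = Sigma UNIV (\<lambda>i. arcs E `` {i})" by auto
  have row: "x $ i * (A_alpha \<alpha> E *v x) $ i =
      (\<Sum>j\<in>arcs E `` {i}. \<alpha> * (x $ i)\<^sup>2 + (1 - \<alpha>) * (x $ i * x $ j))" for i
  proof -
    have "(A_alpha \<alpha> E *v x) $ i = (\<Sum>j\<in>UNIV. (if i = j then \<alpha> * real (degree E i) * x $ j else 0)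
        + (if j \<in> arcs E `` {i} then (1 - \<alpha>) * x $ j else 0))"
      by (auto simp: matrix_vector_mult_def A_alpha_def degree_matrix_def adjacency_matrix_def
          arcs_def algebra_simps intro!: sum.cong)
    also have "\<dots> = \<alpha> * real (degree E i) * x $ i + (\<Sum>j\<in>arcs E `` {i}. (1 - \<alpha>) * x $ j)"
      unfolding sum.distrib by (simp add: sum.If_cases del: Image_singleton_iff)
    finally have "x $ i * (A_alpha \<alpha> E *v x) $ i = real (degree E i) * (\<alpha> * (x $ i)\<^sup>2)
        + x $ i * (\<Sum>j\<in>arcs E `` {i}. (1 - \<alpha>) * x $ j)"
      by (simp only: power2_eq_square ring_distribs mult_ac)
    also have "x $ i * (\<Sum>j\<in>arcs E `` {i}. (1 - \<alpha>) * x $ j)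
        = (\<Sum>j\<in>arcs E `` {i}. (1 - \<alpha>) * (x $ i * x $ j))"
      by (simp only: sum_distrib_left mult_ac)
    finally show ?thesis
      by (simp add: degree_eq_card_arcs[OF assms] sum.distrib)
  qed
  have "x \<bullet> (A_alpha \<alpha> E *v x) = (\<Sum>i\<in>UNIV. x $ i * (A_alpha \<alpha> E *v x) $ i)"
    by (simp add: inner_vec_def)
  also have "\<dots> = (\<Sum>(i, j)\<in>Sigma UNIV (\<lambda>i. arcs E `` {i}). \<alpha> * (x $ i)\<^sup>2 + (1 - \<alpha>) * (x $ i * x $ j))"
    unfolding row by (rule sum.Sigma) auto
  finally show ?thesis using arcs by simp
qed

lemma arc_sum_le_largest_eigenvalue:
  fixes x :: "real^'v"
  assumes "simple_graph E" and "0 \<le> \<alpha>" and "\<alpha> \<le> 1" and "\<And>v. 0 \<le> x $ v" and "P \<subseteq> arcs E"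
  shows "(\<Sum>(i, j)\<in>P. \<alpha> * (x $ i)\<^sup>2 + (1 - \<alpha>) * (x $ i * x $ j))
    \<le> largest_eigenvalue (A_alpha \<alpha> E) * (\<Sum>v\<in>UNIV. (x $ v)\<^sup>2)"
proof -
  have "(\<Sum>(i, j)\<in>P. \<alpha> * (x $ i)\<^sup>2 + (1 - \<alpha>) * (x $ i * x $ j))
      \<le> (\<Sum>(i, j)\<in>arcs E. \<alpha> * (x $ i)\<^sup>2 + (1 - \<alpha>) * (x $ i * x $ j))"
    using assms by (intro sum_mono2) auto
  also have "\<dots> \<le> largest_eigenvalue (A_alpha \<alpha> E) * (x \<bullet> x)"
    unfolding A_alpha_quadratic_form[OF assms(1), symmetric]
    by (rule rayleigh_le_largest_eigenvalue[OF transpose_A_alpha])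
  finally show ?thesis by (simp add: inner_vec_def power2_eq_square)
qed

text \<open>The test vector is \<open>a\<close> on \<open>S\<close>, \<open>b\<close> on
  \<open>T\<close> and zero elsewhere. Only edges between \<open>S\<close> and \<open>T\<close> are
  kept, each in both directions: the arc from \<open>S\<close> has its square term from
  \<open>a\<close>, the reverse arc from \<open>b\<close>.\<close>

lemma bipartite_arcs_le_largest_eigenvalue:
  assumes "simple_graph E" and "0 \<le> \<alpha>" and "\<alpha> \<le> 1" and "0 \<le> a" and "0 \<le> b"
    and disj: "S \<inter> T = {}"
  shows "real (card (arcs E \<inter> S \<times> T)) * (\<alpha> * (a\<^sup>2 + b\<^sup>2) + 2 * (1 - \<alpha>) * (a * b))
    \<le> largest_eigenvalue (A_alpha \<alpha> E) * (a\<^sup>2 * real (card S) + b\<^sup>2 * real (card T))"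
proof -
  define x :: "real^'a" where "x = (\<chi> v. if v \<in> S then a else if v \<in> T then b else 0)"
  let ?F = "arcs E \<inter> S \<times> T" and ?g = "\<lambda>(i, j). \<alpha> * (x $ i)\<^sup>2 + (1 - \<alpha>) * (x $ i * x $ j)"
  have "sum ?g (?F \<union> ?F\<inverse>) \<le> largest_eigenvalue (A_alpha \<alpha> E) * (\<Sum>v\<in>UNIV. (x $ v)\<^sup>2)"
  proof (rule arc_sum_le_largest_eigenvalue)
    show "?F \<union> ?F\<inverse> \<subseteq> arcs E" by (auto simp: arcs_def insert_commute)
  qed (use assms in \<open>auto simp: x_def\<close>)
  moreover have "sum ?g (?F \<union> ?F\<inverse>) = sum ?g ?F + sum ?g (?F\<inverse>)"
    using disj by (intro sum.union_disjoint) auto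
  moreover have "sum ?g ?F = (\<Sum>p\<in>?F. \<alpha> * a\<^sup>2 + (1 - \<alpha>) * (a * b))"
    using disj by (intro sum.cong) (auto simp: x_def)
  moreover have "sum ?g (?F\<inverse>) = (\<Sum>p\<in>?F\<inverse>. \<alpha> * b\<^sup>2 + (1 - \<alpha>) * (a * b))"
    using disj by (intro sum.cong) (auto simp: x_def)
  moreover have "card (?F\<inverse>) = card ?F"
    by (rule card_inverse)
  moreover have "(\<Sum>v\<in>UNIV. (x $ v)\<^sup>2) = a\<^sup>2 * real (card S) + b\<^sup>2 * real (card T)"
  proof -
    have "(\<Sum>v\<in>UNIV. (x $ v)\<^sup>2) = (\<Sum>v\<in>UNIV. (if v \<in> S then a\<^sup>2 else 0) + (if v \<in> T then b\<^sup>2 else 0))"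
      using disj by (intro sum.cong) (auto simp: x_def)
    then show ?thesis by (simp add: sum.distrib sum.If_cases)
  qed
  ultimately show ?thesis by (simp add: algebra_simps)
qed

text \<open>On the indicator vector of \<open>S\<close> every arc inside \<open>S\<close>
  contributes \<alpha> + (1 - \<alpha>) = 1, which is why the bound does not depend on
  \<alpha>.\<close>

lemma clique_le_largest_eigenvalue:
  assumes "simple_graph E" and "0 \<le> \<alpha>" and "\<alpha> \<le> 1"
    and "S \<noteq> {}" and clique: "S \<times> S - Id \<subseteq> arcs E"
  shows "real (card S) - 1 \<le> largest_eigenvalue (A_alpha \<alpha> E)"
proof -
  define x :: "real^'a" where "x = (\<chi> v. if v \<in> S then 1 else 0)"
  have pos: "card S > 0" using assms(4) by (simp add: card_gt_0_iff)
  have "card (S \<times> S - Id) = card S * card S - card S"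
  proof -
    have "S \<times> S - Id = S \<times> S - (\<lambda>v. (v, v)) ` S" by auto
    moreover have "card ((\<lambda>v. (v, v)) ` S) = card S" by (rule card_image) (auto simp: inj_on_def)
    ultimately show ?thesis by (simp add: card_Diff_subset card_cartesian_product image_subset_iff)
  qed
  then have "real (card (S \<times> S - Id)) = real (card S) * (real (card S) - 1)"
    by (simp add: of_nat_diff algebra_simps)
  moreover have "(\<Sum>(i, j)\<in>S \<times> S - Id. \<alpha> * (x $ i)\<^sup>2 + (1 - \<alpha>) * (x $ i * x $ j))
      = (\<Sum>p\<in>S \<times> S - Id. 1)"
    by (intro sum.cong) (auto simp: x_def)
  moreover have "(\<Sum>(i, j)\<in>S \<times> S - Id. \<alpha> * (x $ i)\<^sup>2 + (1 - \<alpha>) * (x $ i * x $ j))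
      \<le> largest_eigenvalue (A_alpha \<alpha> E) * (\<Sum>v\<in>UNIV. (x $ v)\<^sup>2)"
    by (rule arc_sum_le_largest_eigenvalue) (use assms in \<open>auto simp: x_def\<close>)
  moreover have "(\<Sum>v\<in>UNIV. (x $ v)\<^sup>2) = real (card S)"
    by (simp add: x_def if_distrib[of "\<lambda>t. t\<^sup>2"] sum.If_cases cong: if_cong)
  ultimately have "real (card S) * (real (card S) - 1) \<le> real (card S) * largest_eigenvalue (A_alpha \<alpha> E)"
    by (simp add: mult.commute)
  with pos show ?thesis by simp
qed

section \<open>The fractional Tutte--Berge formula\<close>

text \<open>Rado's argument: a minimal subrelation satisfying the deficiency condition is single-valued,
  since if two values of \<open>x\<close> could not be removed, submodularity of \<open>J \<mapsto> |R(J)|\<close> would contradict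
  the condition.\<close>

lemma hall_deficiency:
  fixes R :: "('a::finite \<times> 'b::finite) set"
  assumes "\<And>J. card J \<le> card (R `` J) + d"
  obtains M where "M \<subseteq> R" and "single_valued M" and "single_valued (M\<inverse>)"
    and "CARD('a) \<le> card M + d"
proof -
  define P where "P Q \<longleftrightarrow> (\<forall>J. card J \<le> card (Q `` J) + d)" for Q :: "('a \<times> 'b) set"
  define good where "good = {Q. Q \<subseteq> R \<and> P Q}"
  have "finite good" "R \<in> good" using assms by (auto simp: good_def P_def)
  then obtain Q where Q: "Q \<in> good" and min: "\<And>Q'. Q' \<in> good \<Longrightarrow> Q' \<subseteq> Q \<Longrightarrow> Q' = Q"
    by (metis finite_has_minimal2)
  have PQ: "card J \<le> card (Q `` J) + d" for J using Q by (auto simp: good_def P_def)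
  \<comment> \<open>By minimality, deleting \<open>(x, y)\<close> breaks the condition at some set,
    which must contain \<open>x\<close>. Removing \<open>x\<close> from that set turns the strict
    inequality into a weak one.\<close>
  have violate: "\<exists>J. x \<notin> J \<and> card (Q `` J \<union> (Q `` {x} - {y})) + d \<le> card J" if "(x, y) \<in> Q" for x y
  proof -
    have "Q - {(x, y)} \<notin> good" using min[of "Q - {(x, y)}"] that by auto
    then obtain J where J: "card ((Q - {(x, y)}) `` J) + d < card J"
      using Q by (auto simp: good_def P_def not_le)
    have xJ: "x \<in> J"
    proof (rule ccontr)
      assume "x \<notin> J"
      then have "(Q - {(x, y)}) `` J = Q `` J" by auto
      with J PQ[of J] show False by simp
    qed
    then have "(Q - {(x, y)}) `` J \<supseteq> Q `` (J - {x}) \<union> (Q `` {x} - {y})" by auto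
    then have "card (Q `` (J - {x}) \<union> (Q `` {x} - {y})) \<le> card ((Q - {(x, y)}) `` J)"
      by (intro card_mono) auto
    moreover have "card J = Suc (card (J - {x}))" using xJ by (metis card_Suc_Diff1 finite)
    ultimately show ?thesis using J by (intro exI[of _ "J - {x}"]) auto
  qed
  have sv: "single_valued Q"
  proof (rule single_valuedI, rule ccontr)
    fix x y z assume xy: "(x, y) \<in> Q" and xz: "(x, z) \<in> Q" and "y \<noteq> z"
    obtain J where J: "x \<notin> J" "card (Q `` J \<union> (Q `` {x} - {y})) + d \<le> card J"
      using violate[OF xy] by blast
    obtain K where K: "x \<notin> K" "card (Q `` K \<union> (Q `` {x} - {z})) + d \<le> card K"
      using violate[OF xz] by blast
    let ?A = "Q `` J \<union> (Q `` {x} - {y})" and ?B = "Q `` K \<union> (Q `` {x} - {z})"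
    \<comment> \<open>As \<open>y\<close> and \<open>z\<close> differ, every value of
      \<open>x\<close> survives in at least one of the two sets.\<close>
    have "Q `` insert x (J \<union> K) \<subseteq> ?A \<union> ?B" using \<open>y \<noteq> z\<close> by auto
    then have "card (Q `` insert x (J \<union> K)) \<le> card (?A \<union> ?B)" by (intro card_mono) auto
    moreover have "card (Q `` (J \<inter> K)) \<le> card (?A \<inter> ?B)" by (intro card_mono) auto
    moreover have "card ?A + card ?B = card (?A \<union> ?B) + card (?A \<inter> ?B)"
      by (rule card_Un_Int) auto
    moreover have "card J + card K = card (J \<union> K) + card (J \<inter> K)"
      by (rule card_Un_Int) auto
    moreover have "card (insert x (J \<union> K)) = Suc (card (J \<union> K))" using J K by simp
    ultimately show False
      using J(2) K(2) PQ[of "insert x (J \<union> K)"] PQ[of "J \<inter> K"] by linarith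
  qed
  \<comment> \<open>\<open>Q\<close> may still send several points to one value. Keeping one
    preimage per value makes the converse single-valued too, and the condition at
    \<open>UNIV\<close> bounds the number of values from below.\<close>
  define g where "g y = (SOME x. (x, y) \<in> Q)" for y
  define M where "M = (\<lambda>y. (g y, y)) ` (Q `` UNIV)"
  have g: "(g y, y) \<in> Q" if "y \<in> Q `` UNIV" for y
    using that unfolding g_def by (auto intro: someI)
  have "card M = card (Q `` UNIV)"
    unfolding M_def by (rule card_image) (auto simp: inj_on_def)
  moreover have "M \<subseteq> Q" using g by (auto simp: M_def)
  moreover have "single_valued (M\<inverse>)" by (auto simp: M_def single_valued_def)
  ultimately show thesis
    using that[of M] Q PQ[of UNIV] single_valued_subset[OF _ sv] by (auto simp: good_def)
qed

text \<open>Every arc of \<open>M\<close> puts weight 1/2 on its edge. A vertex is the tail of at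
  most one arc and the head of at most one, so its load is at most 1.\<close>

lemma fractional_matching_number_ge_half_card:
  assumes M: "M \<subseteq> arcs E" "single_valued M" "single_valued (M\<inverse>)"
  shows "real (card M) / 2 \<le> fractional_matching_number E"
proof -
  define f where "f e = real (card {p \<in> M. {fst p, snd p} = e}) / 2" for e
  have sum_f: "sum f F = real (card {p \<in> M. {fst p, snd p} \<in> F}) / 2" for F
  proof -
    have "(\<Sum>e\<in>F. card {p \<in> M. {fst p, snd p} = e}) = card (\<Union>e\<in>F. {p \<in> M. {fst p, snd p} = e})"
      by (subst card_UN_disjoint) auto
    moreover have "(\<Union>e\<in>F. {p \<in> M. {fst p, snd p} = e}) = {p \<in> M. {fst p, snd p} \<in> F}" by auto
    ultimately have "real (\<Sum>e\<in>F. card {p \<in> M. {fst p, snd p} = e})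
        = real (card {p \<in> M. {fst p, snd p} \<in> F})" by simp
    then show ?thesis by (simp add: f_def flip: sum_divide_distrib)
  qed
  have card_le_1: "card A \<le> 1" if "\<And>p q. p \<in> A \<Longrightarrow> q \<in> A \<Longrightarrow> p = q" for A :: "('a \<times> 'a) set"
    using that by (simp add: card_le_Suc0_iff_eq)
  have vertex: "sum f {e \<in> E. v \<in> e} \<le> 1" for v
  proof -
    have "{p \<in> M. {fst p, snd p} \<in> {e \<in> E. v \<in> e}} \<subseteq> {p \<in> M. fst p = v} \<union> {p \<in> M. snd p = v}"
      by auto
    then have "card {p \<in> M. {fst p, snd p} \<in> {e \<in> E. v \<in> e}}
        \<le> card ({p \<in> M. fst p = v} \<union> {p \<in> M. snd p = v})"
      by (intro card_mono) auto
    also have "\<dots> \<le> card {p \<in> M. fst p = v} + card {p \<in> M. snd p = v}" by (rule card_Un_le)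
    also have "card {p \<in> M. fst p = v} \<le> 1"
      using M(2) by (intro card_le_1) (auto simp: single_valued_def)
    also have "card {p \<in> M. snd p = v} \<le> 1"
      using M(3) by (intro card_le_1) (auto simp: single_valued_def)
    finally show ?thesis by (simp add: sum_f)
  qed
  \<comment> \<open>The weight of a used edge is part of the load at one of its endpoints.\<close>
  have edge: "f e \<le> 1" for e
  proof (cases "\<exists>p\<in>M. {fst p, snd p} = e")
    case True
    then obtain p where p: "p \<in> M" "{fst p, snd p} = e" by blast
    then have "e \<in> E" using M(1) by (auto simp: arcs_def)
    then have "f e \<le> sum f {e \<in> E. fst p \<in> e}"
      using p(2) by (intro member_le_sum) (auto simp: f_def)
    with vertex show ?thesis by (meson order_trans)
  next
    case False
    then have "{p \<in> M. {fst p, snd p} = e} = {}" by blast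
    then show ?thesis by (simp only: f_def card.empty)
  qed
  have "fractional_matching E f"
    unfolding fractional_matching_def using vertex edge by (simp add: f_def)
  moreover have "{p \<in> M. {fst p, snd p} \<in> E} = M" using M(1) by (auto simp: arcs_def)
  ultimately show ?thesis
    using fractional_matching_number_maximum(2)[of E f] by (simp add: sum_f)
qed

lemma fractional_tutte_berge:
  fixes E :: "'v::finite set set" and k :: real
  assumes "0 < k" and "fractional_matching_number E \<le> (real CARD('v) - k) / 2"
  obtains S where "S \<inter> arcs E `` S = {}" and "real (card (arcs E `` S)) + k \<le> real (card S)"
proof -
  \<comment> \<open>This is the largest integer strictly below \<open>k\<close>. Deficiency
    \<open>d\<close> would give a fractional matching of size at least \<open>(n - d) / 2\<close>,
    which is too large; exceeding \<open>d\<close> means a deficiency of at least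
    \<open>k\<close>.\<close>
  define d where "d = nat \<lceil>k\<rceil> - 1"
  have d: "real d < k" using assms(1) unfolding d_def by linarith
  have "\<exists>J. \<not> card J \<le> card (arcs E `` J) + d"
  proof (rule ccontr)
    assume "\<not> ?thesis"
    then obtain M where "M \<subseteq> arcs E" "single_valued M" "single_valued (M\<inverse>)" "CARD('v) \<le> card M + d"
      using hall_deficiency[of "arcs E" d] by blast
    with fractional_matching_number_ge_half_card[of M E] assms(2) d show False by simp
  qed
  then obtain J where "card (arcs E `` J) + d < card J" by (auto simp: not_le)
  then have "card (arcs E `` J) + nat \<lceil>k\<rceil> \<le> card J" using assms(1) unfolding d_def by linarith
  then have J: "real (card (arcs E `` J)) + k \<le> real (card J)" by linarith
  have arcs_sym: "(v, u) \<in> arcs E" if "(u, v) \<in> arcs E" for u v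
    using that by (simp add: arcs_def insert_commute)
  \<comment> \<open>Discard from \<open>J\<close> the vertices that have a neighbour in
    \<open>J\<close>. The remaining ones have all neighbours outside \<open>J\<close>, so
    \<open>card J\<close> drops by \<open>card (?N \<inter> J)\<close> and the neighbourhood by at
    least as much.\<close>
  let ?N = "arcs E `` J" and ?S = "J - arcs E `` J"
  have sub: "arcs E `` ?S \<subseteq> ?N - J"
    using arcs_sym by blast
  have "card (arcs E `` ?S) \<le> card (?N - J)" by (rule card_mono[OF _ sub]) simp
  moreover have "card (?N - J) + card (?N \<inter> J) = card ?N"
    by (metis card_Diff_subset_Int card_mono finite inf_le1 le_add_diff_inverse2)
  moreover have "card ?S + card (?N \<inter> J) = card J"
    by (metis Int_commute card_Diff_subset_Int card_mono finite inf_le1 le_add_diff_inverse2)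
  ultimately show thesis
    using that[of ?S] sub J by force
qed

section \<open>Eigenvalue bounds from a deficient independent set\<close>

theorem corollary1p6:
  fixes E :: "'v::finite set set" and n \<delta> :: nat and k \<alpha> :: real
  assumes "simple_graph E" and "connected_graph E"
    and "n = CARD('v)" and "\<delta> = min_degree E"
    and "0 < k" and "k < real n"
    and "real \<delta> \<le> (real n - k) / 2"
    and "0 \<le> \<alpha>" and "\<alpha> \<le> 1"
  shows
    "(\<alpha> = 0 \<and> largest_eigenvalue (A_alpha \<alpha> E) < real \<delta> * sqrt (1 + 2 * k / (real n - k))
        \<longrightarrow> fractional_matching_number E > (real n - k) / 2) \<and>
     (0 < \<alpha> \<and> \<alpha> \<le> 1 / 2 \<and> largest_eigenvalue (A_alpha \<alpha> E) < 2 * \<alpha> * real \<delta> * real n / (real n - k)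
        \<longrightarrow> fractional_matching_number E > (real n - k) / 2) \<and>
     (1 / 2 < \<alpha> \<and> \<alpha> \<le> 1 \<and> largest_eigenvalue (A_alpha \<alpha> E) < \<alpha> * real \<delta> * (real n + k) / (real n - k)
        \<longrightarrow> fractional_matching_number E > (real n - k) / 2) \<and>
     (largest_eigenvalue (A_alpha \<alpha> (graph_complement E)) < real \<delta> + k - 1
        \<longrightarrow> fractional_matching_number E > (real n - k) / 2)"
proof (cases "fractional_matching_number E > (real n - k) / 2")
  \<comment> \<open>With a small matching number, each of the four eigenvalue hypotheses is refuted
    by a reverse inequality.\<close>
  case False
  then obtain S where indep: "S \<inter> arcs E `` S = {}"
    and card_S: "real (card (arcs E `` S)) + k \<le> real (card S)"
    using fractional_tutte_berge[of k E] assms(3,5) by (auto simp: not_less)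
  define T where "T = arcs E `` S"
  define s t where "s = real (card S)" and "t = real (card T)"
  define l where "l = largest_eigenvalue (A_alpha \<alpha> E)"
  have st: "t + k \<le> s" using card_S by (simp add: s_def t_def T_def)
  have t0: "0 \<le> t" by (simp add: t_def)
  have s0: "0 < s" using st t0 assms(5) by simp
  have "card S + card T = card (S \<union> T)"
    using indep by (intro card_Un_disjoint[symmetric]) (auto simp: T_def)
  also have "\<dots> \<le> n" unfolding assms(3) by (rule card_mono) auto
  finally have "s + t \<le> real n" unfolding s_def t_def by linarith
  then have t_le: "2 * t \<le> real n - k" using st by simp
  have deg: "\<delta> \<le> card (arcs E `` {v})" for v
    unfolding assms(4) min_degree_def degree_eq_card_arcs[OF assms(1), symmetric] by (rule Min_le) auto
  have \<delta>_le_t: "real \<delta> \<le> t"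
  proof -
    obtain v where "v \<in> S" using s0 by (force simp: s_def)
    then have "arcs E `` {v} \<subseteq> T" by (auto simp: T_def)
    then have "card (arcs E `` {v}) \<le> card T" by (rule card_mono[rotated]) simp
    then show ?thesis using deg[of v] by (simp add: t_def)
  qed
  have edges: "real \<delta> * s \<le> real (card (arcs E \<inter> S \<times> T))"
  proof -
    have "arcs E \<inter> S \<times> T = Sigma S (\<lambda>v. arcs E `` {v})" by (auto simp: T_def)
    then have "card (arcs E \<inter> S \<times> T) = (\<Sum>v\<in>S. card (arcs E `` {v}))" by simp
    moreover have "(\<Sum>v\<in>S. \<delta>) \<le> (\<Sum>v\<in>S. card (arcs E `` {v}))" by (intro sum_mono deg)
    ultimately have "card S * \<delta> \<le> card (arcs E \<inter> S \<times> T)" by simp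
    then show ?thesis by (simp add: s_def mult.commute flip: of_nat_mult)
  qed
  have test: "real \<delta> * s * (\<alpha> * (a\<^sup>2 + b\<^sup>2) + 2 * (1 - \<alpha>) * (a * b)) \<le> l * (a\<^sup>2 * s + b\<^sup>2 * t)"
    if "0 \<le> a" "0 \<le> b" for a b
  proof -
    have "real \<delta> * s * (\<alpha> * (a\<^sup>2 + b\<^sup>2) + 2 * (1 - \<alpha>) * (a * b))
        \<le> real (card (arcs E \<inter> S \<times> T)) * (\<alpha> * (a\<^sup>2 + b\<^sup>2) + 2 * (1 - \<alpha>) * (a * b))"
      using edges that assms(8,9) by (intro mult_right_mono) auto
    also have "\<dots> \<le> l * (a\<^sup>2 * s + b\<^sup>2 * t)"
      unfolding l_def s_def t_def using that assms indep
      by (intro bipartite_arcs_le_largest_eigenvalue) (auto simp: T_def)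
    finally show ?thesis .
  qed
  have nk: "0 < real n - k" using assms(6) by simp
  have l0: "0 \<le> l"
  proof -
    have "0 \<le> real \<delta> * s * (\<alpha> * (1\<^sup>2 + 1\<^sup>2) + 2 * (1 - \<alpha>) * (1 * 1))"
      using s0 assms(8,9) by simp
    also have "\<dots> \<le> l * (s + t)" using test[of 1 1] by simp
    finally show ?thesis using s0 t0 by (simp add: zero_le_mult_iff)
  qed
  define r where "r = 1 + 2 * k / (real n - k)"
  have r: "r = (real n + k) / (real n - k)" "1 + r = 2 * real n / (real n - k)"
    using nk by (simp_all add: r_def field_simps)
  \<comment> \<open>For positive \<open>t\<close>, \<open>s / t\<close> is at least
    \<open>1 + k / t\<close>, and \<open>t\<close> is at most \<open>(n - k) / 2\<close>. The
    product form also covers \<open>t = 0\<close>.\<close>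
  have ratio: "r * t \<le> s"
  proof -
    have "k * (2 * t) \<le> k * (real n - k)" using t_le assms(5) by (intro mult_left_mono) auto
    then have "2 * k / (real n - k) * t \<le> k" using nk by (simp add: field_simps)
    then show ?thesis using st by (simp add: r_def algebra_simps)
  qed
  \<comment> \<open>This permits cancelling \<open>t\<close>: if \<open>t = 0\<close>, then \<delta>
    = 0 and only \<open>0 \<le> l\<close> is claimed.\<close>
  have bound: "real \<delta> * c \<le> l" if "0 < t \<Longrightarrow> real \<delta> * c * t \<le> l * t" for c
  proof (cases "0 < t")
    case True
    with that show ?thesis by simp
  next
    case False
    then have "\<delta> = 0" using \<delta>_le_t by simp
    with l0 show ?thesis by simp
  qed
  have "real \<delta> * sqrt r \<le> l" if "\<alpha> = 0"
  proof (rule bound)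
    \<comment> \<open>These weights give \<open>S\<close> and \<open>T\<close> equal shares of the
      squared norm. They form the Perron vector of a bipartite graph with all degrees \<delta> on
      \<open>S\<close> and \<delta> s / t on \<open>T\<close>, and yield \<delta> times the square
      root of \<open>s / t\<close>.\<close>
    have "2 * s * (real \<delta> * sqrt (s * t)) \<le> 2 * s * (l * t)"
      using test[of "sqrt t" "sqrt s"] that s0 t0 by (simp add: real_sqrt_mult algebra_simps)
    then have "real \<delta> * sqrt (s * t) \<le> l * t" using s0 by simp
    moreover have "sqrt r * t \<le> sqrt (s * t)"
    proof -
      have "sqrt r * t = sqrt (r * t * t)" using t0 by (simp add: real_sqrt_mult mult.assoc)
      also have "\<dots> \<le> sqrt (s * t)" using ratio t0 by (simp add: mult_right_mono)
      finally show ?thesis .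
    qed
    then have "real \<delta> * (sqrt r * t) \<le> real \<delta> * sqrt (s * t)" by (rule mult_left_mono) simp
    ultimately show "real \<delta> * sqrt r * t \<le> l * t" by (simp add: mult.assoc)
  qed
  moreover have "real \<delta> * (\<alpha> * (1 + r)) \<le> l" if "\<alpha> \<le> 1 / 2"
  proof (rule bound)
    \<comment> \<open>For \<alpha> at most 1/2 the cross term can be lowered until a perfect square
      appears. The weights \<open>t\<close> on \<open>S\<close> and \<open>s\<close> on
      \<open>T\<close> then make the norm factor as \<open>s * t * (s + t)\<close>, leaving \<delta>
      \<alpha> (1 + s / t).\<close>
    have "\<alpha> * (s * t) \<le> (1 - \<alpha>) * (s * t)" using that s0 t0 by (intro mult_right_mono) auto
    then have "\<alpha> * (s + t)\<^sup>2 \<le> \<alpha> * (t\<^sup>2 + s\<^sup>2) + 2 * (1 - \<alpha>) * (t * s)"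
      by (simp add: power2_eq_square algebra_simps)
    then have "real \<delta> * s * (\<alpha> * (s + t)\<^sup>2)
        \<le> real \<delta> * s * (\<alpha> * (t\<^sup>2 + s\<^sup>2) + 2 * (1 - \<alpha>) * (t * s))"
      using s0 by (intro mult_left_mono) auto
    also have "\<dots> \<le> l * (t\<^sup>2 * s + s\<^sup>2 * t)" using test[of t s] t0 s0 by simp
    finally have "(s * (s + t)) * (real \<delta> * \<alpha> * (s + t)) \<le> (s * (s + t)) * (l * t)"
      by (simp add: power2_eq_square algebra_simps)
    then have "real \<delta> * \<alpha> * (s + t) \<le> l * t"
      by (rule mult_left_le_imp_le) (use t0 s0 in simp)
    moreover have "real \<delta> * \<alpha> * (r * t) \<le> real \<delta> * \<alpha> * s"
      using ratio assms(8) by (intro mult_left_mono) auto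
    ultimately show "real \<delta> * (\<alpha> * (1 + r)) * t \<le> l * t" by (simp add: algebra_simps)
  qed
  moreover have "real \<delta> * (\<alpha> * r) \<le> l"
  proof (rule bound)
    \<comment> \<open>The test vector is the indicator of \<open>T\<close>, so only the degree part
      of the matrix contributes.\<close>
    have "real \<delta> * \<alpha> * (r * t) \<le> real \<delta> * \<alpha> * s"
      using ratio assms(8) by (intro mult_left_mono) auto
    then show "real \<delta> * (\<alpha> * r) * t \<le> l * t"
      using test[of 0 1] by (simp add: algebra_simps)
  qed
  moreover have "real \<delta> + k - 1 \<le> largest_eigenvalue (A_alpha \<alpha> (graph_complement E))"
  proof -
    have "real (card S) - 1 \<le> largest_eigenvalue (A_alpha \<alpha> (graph_complement E))"
    proof (rule clique_le_largest_eigenvalue)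
      show "simple_graph (graph_complement E)" by (simp add: simple_graph_def graph_complement_def)
      show "S \<noteq> {}" using s0 by (auto simp: s_def)
      show "S \<times> S - Id \<subseteq> arcs (graph_complement E)"
        using indep by (auto simp: arcs_def graph_complement_def)
    qed (use assms in auto)
    \<comment> \<open>The size of \<open>S\<close> is at least \<open>t + k\<close>, and
      \<open>t\<close> is at least \<delta> because \<open>T\<close> contains all neighbours of a
      vertex of \<open>S\<close>.\<close>
    then show ?thesis using st \<delta>_le_t by (simp add: s_def)
  qed
  moreover have "2 * \<alpha> * real \<delta> * real n / (real n - k) = real \<delta> * (\<alpha> * (1 + r))"
    unfolding r(2) by simp
  moreover have "\<alpha> * real \<delta> * (real n + k) / (real n - k) = real \<delta> * (\<alpha> * r)"
    unfolding r(1) by simp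
  ultimately show ?thesis
    unfolding l_def[symmetric] r_def[symmetric] by (auto simp: not_less)
qed simp

end
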